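(* Let $\Delta\neq\mathbb{N}$ be a numerical semigroup, let $d\ge2$ be an integer, and let $a\in\Delta\setminus\{0\}$ with $a+1\in\Delta$. Let $m=m(\Delta)$ and let $S=\Delta_d(a)=d\Delta\cup\bigcup_{i=1}^{d-1}(da+i+d\Delta)$, which is a numerical semigroup. Then $$\operatorname{Ap}(S,dm)=d\operatorname{Ap}(\Delta,m)\ \cup\ \bigcup_{i=1}^{d-1}\bigl(da+i+d\operatorname{Ap}(\Delta,m)\bigr),$$ and this union is disjoint.
   Context: $\mathbb{N}=\{0,1,2,\dots\}$. A numerical semigroup is a submonoid of $(\mathbb{N},+)$ with finite complement in $\mathbb{N}$. For a numerical semigroup $S$, $m(S)=\min(S\setminus\{0\})$ is its multiplicity, and for a nonzero $q\in S$ the Apéry set is $\operatorname{Ap}(S,q)=\{s\in S: s-q\notin S\}$ (with $s-q$ computed in $\mathbb{Z}$). $dA=\{dx: x\in A\}$ and $k+A=\{k+x:x\in A\}$ for $A\subseteq\mathbb{N}$ and $k\in\mathbb{N}$. *)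

theory Defs
  imports Main "HOL-Library.Set_Algebras" "HOL-Library.Disjoint_Sets"
begin

definition numerical_semigroup :: "nat set \<Rightarrow> bool" where
  "numerical_semigroup S \<longleftrightarrow>
     0 \<in> S \<and> (\<forall>x\<in>S. \<forall>y\<in>S. x + y \<in> S) \<and> finite (- S)"

definition multiplicity_ns :: "nat set \<Rightarrow> nat" where
  "multiplicity_ns S = (LEAST n. n \<in> S - {0})"

text \<open>The difference \<open>s - q\<close> is taken in the integers, since subtraction on \<open>nat\<close> truncates.\<close>

definition Apery :: "nat set \<Rightarrow> nat \<Rightarrow> nat set" where
  "Apery S q = {s \<in> S. int s - int q \<notin> int ` S}"

text \<open>Here \<open>d *o A\<close> and \<open>k +o A\<close> are the dilate \<open>dA\<close> and the translate \<open>k + A\<close>.\<close>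

definition dilated_semigroup :: "nat set \<Rightarrow> nat \<Rightarrow> nat \<Rightarrow> nat set" where
  "dilated_semigroup \<Delta> d a =
     (d *o \<Delta>) \<union> (\<Union>i\<in>{1..d - 1}. (d * a + i) +o (d *o \<Delta>))"

end

theory Submission
  imports Defs
begin

text \<open>Sort the elements of \<open>S\<close> by their residue modulo \<open>d\<close>. Those of
  residue \<open>i < d\<close> are the numbers \<open>d * (c + x) + i\<close> with \<open>x\<close>
  in \<open>\<Delta>\<close>, where \<open>c\<close> is 0 for \<open>i = 0\<close> and
  \<open>a\<close> otherwise (\<open>dilated_semigroup_iff\<close>). Subtracting
  \<open>d * m\<close> keeps the residue, hence also \<open>c\<close>, and only replaces
  \<open>x\<close> by \<open>x - m\<close>. So the difference lies in \<open>S\<close> exactly when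
  \<open>x - m\<close> lies in \<open>\<Delta>\<close>: taking Apery sets commutes with the
  construction (\<open>Apery_dilated_semigroup\<close>). Disjointness holds because the pieces lie
  in different residue classes.

  That \<open>S\<close> is a numerical semigroup is proved separately, in
  \<open>numerical_semigroup_dilated_semigroup\<close>. \<open>Apery_iff\<close> trades the integer
  difference for a sum of naturals.\<close>

lemma Apery_iff: "s \<in> Apery S q \<longleftrightarrow> s \<in> S \<and> (\<forall>t\<in>S. s \<noteq> q + t)"
proof -
  have "int s - int q = int t \<longleftrightarrow> s = q + t" for t
    by linarith
  then show ?thesis
    by (auto simp: Apery_def image_iff)
qed

text \<open>Uniqueness of quotient and remainder: it splits an equation between elements of two
  residue classes into one for the residues and one for the quotients.\<close>

lemma mult_add_remainder_inject:
  fixes d u v i j :: nat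
  assumes "i < d" "j < d"
  shows "d * u + i = d * v + j \<longleftrightarrow> u = v \<and> i = j"
proof
  assume eq: "d * u + i = d * v + j"
  have "(d * u + i) div d = u" "(d * v + j) div d = v"
    using assms by auto
  with eq show "u = v \<and> i = j"
    by simp
qed simp

definition block_offset :: "nat \<Rightarrow> nat \<Rightarrow> nat" where
  "block_offset a i = (if i = 0 then 0 else a)"

text \<open>The block \<open>d A\<close> joins the translated ones as residue class \<open>0\<close>, with offset \<open>0\<close> in place of \<open>a\<close>.\<close>

lemma dilated_semigroup_iff:
  assumes "d \<ge> 2"
  shows "n \<in> dilated_semigroup A d a \<longleftrightarrow> (\<exists>i<d. \<exists>x\<in>A. n = d * (block_offset a i + x) + i)"
    (is "?L \<longleftrightarrow> ?R")
proof
  assume ?L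
  then consider x where "x \<in> A" "n = d * x"
    | i x where "i \<in> {1..d - 1}" "x \<in> A" "n = d * a + i + d * x"
    by (auto simp: dilated_semigroup_def elt_set_times_def elt_set_plus_def)
  then show ?R
  proof cases
    case 1
    with assms show ?thesis
      by (intro exI[of _ 0]) (auto simp: block_offset_def)
  next
    case (2 i x)
    with assms show ?thesis
      by (intro exI[of _ i]) (auto simp: block_offset_def algebra_simps)
  qed
next
  assume ?R
  then obtain i x where ix: "i < d" "x \<in> A" "n = d * (block_offset a i + x) + i"
    by blast
  show ?L
  proof (cases "i = 0")
    case True
    with ix show ?thesis
      by (auto simp: dilated_semigroup_def elt_set_times_def block_offset_def)
  next
    case False
    with ix have "i \<in> {1..d - 1}" "n = d * a + i + d * x"
      by (auto simp: block_offset_def algebra_simps)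
    then have "n \<in> (d * a + i) +o (d *o A)"
      using ix(2) by (auto simp: elt_set_times_def elt_set_plus_def)
    with \<open>i \<in> {1..d - 1}\<close> show ?thesis
      unfolding dilated_semigroup_def by blast
  qed
qed

text \<open>Closure is the real content. When two residues add up to at least \<open>d\<close>, a
  carry raises the quotient by 1, and \<open>a + 1 \<in> \<Delta>\<close> absorbs it.\<close>

lemma numerical_semigroup_dilated_semigroup:
  assumes \<Delta>: "numerical_semigroup \<Delta>" and d: "d \<ge> 2"
    and a: "a \<in> \<Delta>" "a + 1 \<in> \<Delta>"
  shows "numerical_semigroup (dilated_semigroup \<Delta> d a)"
proof -
  let ?S = "dilated_semigroup \<Delta> d a"
  note S_iff = dilated_semigroup_iff[OF d, of _ \<Delta> a]
  have zero: "0 \<in> \<Delta>" and add: "\<And>x y. x \<in> \<Delta> \<Longrightarrow> y \<in> \<Delta> \<Longrightarrow> x + y \<in> \<Delta>"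
    and fin: "finite (- \<Delta>)"
    using \<Delta> by (auto simp: numerical_semigroup_def)
  have "0 \<in> ?S"
    unfolding S_iff using zero d by (intro exI[of _ 0]) (auto simp: block_offset_def)
  moreover have "s + t \<in> ?S" if st: "s \<in> ?S" "t \<in> ?S" for s t
  proof -
    obtain i x j y where ij: "i < d" "j < d" and xy: "x \<in> \<Delta>" "y \<in> \<Delta>"
      and eq: "s = d * (block_offset a i + x) + i" "t = d * (block_offset a j + y) + j"
      using st unfolding S_iff by blast
    show ?thesis
    proof (cases "i + j < d")
      case True
      \<comment> \<open>No carry. The sum needs one offset \<open>a\<close> unless both residues are
        0; if both are nonzero, two are available and the surplus \<open>a\<close> moves into
        \<open>z\<close>.\<close>
      define z where "z = (if i = 0 \<or> j = 0 then 0 else a) + (x + y)"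
      have "z \<in> \<Delta>"
        using a(1) xy by (auto simp: z_def intro: add)
      moreover have "s + t = d * (block_offset a (i + j) + z) + (i + j)"
        by (auto simp: eq z_def block_offset_def algebra_simps)
      ultimately show ?thesis
        unfolding S_iff using True by blast
    next
      case False
      define k where "k = i + j - d"
      have k: "i + j = d + k" "k < d"
        using False ij by (auto simp: k_def)
      have "i \<noteq> 0" "j \<noteq> 0"
        using False ij by auto
      \<comment> \<open>Both residues are nonzero, so the quotient is
        \<open>2 * a + 1 + x + y\<close>. One \<open>a\<close> joins the carry as
        \<open>a + 1\<close>; the other is the offset of class \<open>k\<close>, or stays in
        \<open>z\<close> when \<open>k = 0\<close>.\<close>
      define z where "z = (if k = 0 then a else 0) + ((a + 1) + (x + y))"
      have "z \<in> \<Delta>"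
        unfolding z_def using a xy zero by (intro add[OF _ add[OF _ add]]) auto
      moreover have "s + t = d * (2 * a + x + y) + (i + j)"
        using \<open>i \<noteq> 0\<close> \<open>j \<noteq> 0\<close> by (simp add: eq block_offset_def algebra_simps)
      then have "s + t = d * (block_offset a k + z) + k"
        unfolding k(1) by (simp add: z_def block_offset_def algebra_simps)
      ultimately show ?thesis
        unfolding S_iff using k(2) by blast
    qed
  qed
  moreover have "finite (- ?S)"
  proof -
    obtain N where N: "\<And>x. x \<ge> N \<Longrightarrow> x \<in> \<Delta>"
      using fin unfolding finite_nat_set_iff_bounded by (meson ComplI not_le)
    \<comment> \<open>The bound leaves a quotient of at least \<open>N\<close> even after an offset
      \<open>a\<close> is removed, so the truncated subtraction below is exact.\<close>
    have "n \<in> ?S" if n: "n \<ge> d * (a + N)" for n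
    proof -
      let ?x = "n div d - block_offset a (n mod d)"
      have "a + N \<le> n div d"
        using n d by (simp add: less_eq_div_iff_mult_less_eq mult.commute)
      then have "?x \<ge> N" "block_offset a (n mod d) + ?x = n div d"
        by (auto simp: block_offset_def)
      moreover have "n = d * (n div d) + n mod d" "n mod d < d"
        using d by auto
      ultimately show ?thesis
        unfolding S_iff using N by metis
    qed
    then have "- ?S \<subseteq> {..<d * (a + N)}"
      by (meson ComplD lessThan_iff not_le subsetI)
    then show ?thesis
      using finite_subset by blast
  qed
  ultimately show ?thesis
    unfolding numerical_semigroup_def by blast
qed

text \<open>Adding \<open>d * m\<close> maps each residue class to itself and acts on the quotient
  as adding \<open>m\<close>, so the Apery condition can be tested inside each class
  separately.\<close>

lemma Apery_dilated_semigroup: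
  assumes d: "d \<ge> 2"
  shows "Apery (dilated_semigroup A d a) (d * m) = dilated_semigroup (Apery A m) d a"
proof -
  have shift: "(\<exists>t\<in>dilated_semigroup A d a. d * (block_offset a i + x) + i = d * m + t)
      \<longleftrightarrow> (\<exists>y\<in>A. x = m + y)" (is "?L \<longleftrightarrow> ?R") if i: "i < d" for i x
  proof
    assume ?L
    then obtain j y where jy: "j < d" "y \<in> A"
      and "d * (block_offset a i + x) + i = d * m + (d * (block_offset a j + y) + j)"
      unfolding dilated_semigroup_iff[OF d] Bex_def by blast
    then have "d * (block_offset a i + x) + i = d * (m + block_offset a j + y) + j"
      by (simp add: algebra_simps)
    \<comment> \<open>Equal residues force equal offsets, which then cancel.\<close>
    then have "block_offset a i + x = m + block_offset a j + y \<and> i = j"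
      by (rule iffD1[OF mult_add_remainder_inject[OF i jy(1)]])
    then have "x = m + y"
      by (elim conjE) simp
    with jy(2) show ?R
      by blast
  next
    assume ?R
    then obtain y where y: "y \<in> A" "x = m + y"
      by blast
    then have "d * (block_offset a i + x) + i = d * m + (d * (block_offset a i + y) + i)"
      by (simp add: algebra_simps)
    moreover have "d * (block_offset a i + y) + i \<in> dilated_semigroup A d a"
      unfolding dilated_semigroup_iff[OF d] using i y(1) by blast
    ultimately show ?L
      by blast
  qed
  show ?thesis
  proof (rule set_eqI)
    fix n
    have "n \<in> Apery (dilated_semigroup A d a) (d * m) \<longleftrightarrow>
        (\<exists>i<d. \<exists>x\<in>A. n = d * (block_offset a i + x) + i) \<and>
        \<not> (\<exists>t\<in>dilated_semigroup A d a. n = d * m + t)"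
      by (simp add: Apery_iff dilated_semigroup_iff[OF d])
    \<comment> \<open>For a fixed representation of \<open>n\<close> by \<open>i\<close> and
      \<open>x\<close>, \<open>shift\<close> turns the condition on \<open>n\<close> into one on
      \<open>x\<close> alone, so it can move under the quantifiers.\<close>
    also have "\<dots> \<longleftrightarrow> (\<exists>i<d. \<exists>x\<in>A. n = d * (block_offset a i + x) + i \<and> \<not> (\<exists>y\<in>A. x = m + y))"
      by (metis shift)
    also have "\<dots> \<longleftrightarrow> n \<in> dilated_semigroup (Apery A m) d a"
      unfolding dilated_semigroup_iff[OF d] by (auto simp: Apery_iff)
    finally show "n \<in> Apery (dilated_semigroup A d a) (d * m) \<longleftrightarrow>
        n \<in> dilated_semigroup (Apery A m) d a" .
  qed
qed

lemma mod_eq_0_if_mem_dilate: "n \<in> d *o A \<Longrightarrow> n mod d = 0" for d :: nat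
  by (auto simp: elt_set_times_def)

lemma mod_eq_if_mem_translated_dilate:
  fixes d i :: nat
  assumes "n \<in> (d * a + i) +o (d *o A)" "i < d"
  shows "n mod d = i"
proof -
  obtain x where "n = d * a + i + d * x"
    using assms(1) unfolding elt_set_times_def elt_set_plus_def by blast
  then have "n = d * (a + x) + i"
    by (simp add: distrib_left)
  with assms(2) show ?thesis
    by simp
qed

theorem proposition3p7:
  fixes \<Delta> S :: "nat set" and d a m :: nat
  assumes "numerical_semigroup \<Delta>" and "\<Delta> \<noteq> UNIV"
    and "d \<ge> 2"
    and "a \<in> \<Delta> - {0}" and "a + 1 \<in> \<Delta>"
  defines "m \<equiv> multiplicity_ns \<Delta>"
    and "S \<equiv> dilated_semigroup \<Delta> d a"
  shows "numerical_semigroup S \<and>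
    Apery S (d * m) =
      (d *o Apery \<Delta> m) \<union> (\<Union>i\<in>{1..d - 1}. (d * a + i) +o (d *o Apery \<Delta> m)) \<and>
    (d *o Apery \<Delta> m) \<inter> (\<Union>i\<in>{1..d - 1}. (d * a + i) +o (d *o Apery \<Delta> m)) = {} \<and>
    disjoint_family_on (\<lambda>i. (d * a + i) +o (d *o Apery \<Delta> m)) {1..d - 1}"
proof (intro conjI)
  show "numerical_semigroup S"
    unfolding S_def using assms by (intro numerical_semigroup_dilated_semigroup) auto
  show "Apery S (d * m) =
      (d *o Apery \<Delta> m) \<union> (\<Union>i\<in>{1..d - 1}. (d * a + i) +o (d *o Apery \<Delta> m))"
    unfolding S_def Apery_dilated_semigroup[OF \<open>d \<ge> 2\<close>] by (simp add: dilated_semigroup_def)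
  \<comment> \<open>The residue recovers the index of the block; as the indices run from 1 to
    \<open>d - 1\<close>, this separates the blocks from one another and from the multiples of
    \<open>d\<close>.\<close>
  have residue: "n mod d = i"
    if "n \<in> (d * a + i) +o (d *o Apery \<Delta> m)" "i \<in> {1..d - 1}" for n i
    using that by (intro mod_eq_if_mem_translated_dilate) auto
  show "(d *o Apery \<Delta> m) \<inter> (\<Union>i\<in>{1..d - 1}. (d * a + i) +o (d *o Apery \<Delta> m)) = {}"
  proof (rule equals0I)
    fix n
    assume "n \<in> (d *o Apery \<Delta> m) \<inter> (\<Union>i\<in>{1..d - 1}. (d * a + i) +o (d *o Apery \<Delta> m))"
    then obtain i where i: "i \<in> {1..d - 1}" and "n \<in> d *o Apery \<Delta> m"
      and "n \<in> (d * a + i) +o (d *o Apery \<Delta> m)"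
      by blast
    then have "n mod d = 0" "n mod d = i"
      by (blast intro: mod_eq_0_if_mem_dilate residue)+
    with i show False
      by simp
  qed
  show "disjoint_family_on (\<lambda>i. (d * a + i) +o (d *o Apery \<Delta> m)) {1..d - 1}"
    unfolding disjoint_family_on_def disjoint_iff using residue by metis
qed

end
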